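(* Let $c\ge 2$ and $n\ge 1$ be integers and let $a\neq b$ be colors in $\{1,\dots,c\}$. Then $\left|\Pi_n^{eq}\wr C_c(1^a2^b)\right|$ equals $$B(n)(c-1)^n+\sum_{i=0}^n\sum_{k=0}^{n-i}\sum_{\ell=0}^{i-1}\binom{n-i}{k}\binom{i-1}{\ell}B(n-k-\ell-1)c^k(c-1)^{i-1}(c-2)^{n-i-k}$$ $$+\sum_{i=0}^{n-1}\sum_{j=i+1}^n\sum_{p+q\le i-1}\sum_{r+s\le j-i-1}\sum_{t+u\le n-j}\binom{i-1}{p,q}\binom{j-i-1}{r,s}\binom{n-j}{t,u}B(n-p-q-r-s-t-u-2)c^r(c-1)^{n-j+i-1}(c-2)^{j-i-r-1}.$$
   Context: $\Pi_n\wr C_c$ denotes the set of colored set partitions of $[n]$: pairs consisting of a set partition of $[n]$ and an assignment of a color in $\{1,\dots,c\}$ to each element. A colored partition eq-contains $1^a2^b$ if there are elements $x<y$ in different blocks with $x$ colored $a$ and $y$ colored $b$; otherwise it eq-avoids $1^a2^b$, and $\Pi_n^{eq}\wr C_c(1^a2^b)$ is the set of those eq-avoiding it. $B(m)$ is the $m$-th Bell number. Sums $\sum_{p+q\le N}$ range over pairs of nonnegative integers (empty if $N<0$); $\binom{N}{p,q}=\frac{N!}{p!\,q!\,(N-p-q)!}$; empty sums are $0$ and $0^0=1$. *)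

theory Defs
  imports Complex_Main "HOL-Library.Disjoint_Sets" "HOL-Library.FuncSet"
begin

definition Bell :: "nat \<Rightarrow> nat" where
  "Bell m = card {P. partition_on {1..m} P}"

text \<open>A coloring is an extensional function, so that it is determined by the colors of the
  elements of \<open>{1..n}\<close> and counting colored partitions is meaningful.\<close>

definition colored_partitions :: "nat \<Rightarrow> nat \<Rightarrow> (nat set set \<times> (nat \<Rightarrow> nat)) set" where
  "colored_partitions n c = {P. partition_on {1..n} P} \<times> ({1..n} \<rightarrow>\<^sub>E {1..c})"

text \<open>Containment of the pattern \<open>1\<^sup>a2\<^sup>b\<close>.\<close>

definition eq_contains_12 :: "nat \<Rightarrow> nat \<Rightarrow> nat set set \<times> (nat \<Rightarrow> nat) \<Rightarrow> bool" where
  "eq_contains_12 a b = (\<lambda>(P, col). \<exists>X\<in>P. \<exists>Y\<in>P. X \<noteq> Y \<and>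
     (\<exists>x\<in>X. \<exists>y\<in>Y. x < y \<and> col x = a \<and> col y = b))"

definition eq_avoiders_12 ::
  "nat \<Rightarrow> nat \<Rightarrow> nat \<Rightarrow> nat \<Rightarrow> (nat set set \<times> (nat \<Rightarrow> nat)) set" where
  "eq_avoiders_12 n c a b = {\<pi> \<in> colored_partitions n c. \<not> eq_contains_12 a b \<pi>}"

text \<open>The bound is an integer, so that the set is empty for a negative bound.\<close>

definition pairs_le :: "int \<Rightarrow> (nat \<times> nat) set" where
  "pairs_le N = {(p, q). int p + int q \<le> N}"

text \<open>Only meaningful for \<open>p + q \<le> N\<close>, in which case the division is exact.\<close>

definition trinomial :: "nat \<Rightarrow> nat \<Rightarrow> nat \<Rightarrow> nat" where
  "trinomial N p q = fact N div (fact p * fact q * fact (N - p - q))"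

lemma trinomial_eq_binomials:
  assumes "p + q \<le> N"
  shows "trinomial N p q = (N choose p) * ((N - p) choose q)"
proof -
  have "fact N = fact p * fact (N - p) * (N choose p)"
    using assms binomial_fact_lemma[of p N] by simp
  moreover have "fact (N - p) = fact q * fact (N - p - q) * ((N - p) choose q)"
    using assms binomial_fact_lemma[of q "N - p"] by simp
  ultimately have "fact N = (fact p * fact q * fact (N - p - q)) * ((N choose p) * ((N - p) choose q))"
    by (simp add: algebra_simps)
  then show ?thesis
    unfolding trinomial_def by (metis fact_nonzero mult_eq_0_iff nonzero_mult_div_cancel_left)
qed

lemma trinomial_exact:
  assumes "p + q \<le> N"
  shows "real (trinomial N p q) = fact N / (fact p * fact q * fact (N - p - q))"
  using assms by (simp add: trinomial_eq_binomials binomial_fact)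

end

theory Submission
  imports Defs
begin

text \<open>If some element has color \<open>a\<close>, let \<open>i\<close> be the least one. Either all elements of color
  \<open>a\<close> lie in the block of \<open>i\<close>, or there is a least element \<open>j\<close> of color \<open>a\<close> outside that block.
  In the first case \<open>b\<close> is forbidden exactly after \<open>i\<close> outside the block of \<open>i\<close>; in the second
  case it is moreover forbidden everywhere after \<open>j\<close>, since no block contains both \<open>i\<close> and \<open>j\<close>.
  So, once the block of \<open>i\<close> (and \<open>j\<close>) is fixed, the admissible colors can be chosen
  independently for each element. The three summands of the formula correspond to the absence
  of the color \<open>a\<close> and to these two cases.\<close>

section \<open>Sums over subsets and over pairs of disjoint subsets\<close>

text \<open>Subsets are grouped by size. This turns sums over possible blocks into the binomial sums
  of the formula.\<close>

lemma sum_Pow_card: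
  fixes f :: "nat \<Rightarrow> nat"
  assumes "finite A"
  shows "(\<Sum>X\<in>Pow A. f (card X)) = (\<Sum>k=0..card A. (card A choose k) * f k)"
proof -
  have "(\<Sum>X\<in>Pow A. f (card X))
      = (\<Sum>k=0..card A. \<Sum>X\<in>{X. X \<in> Pow A \<and> card X = k}. f (card X))"
    using assms by (intro sum.group[symmetric]) (auto intro: card_mono)
  also have "\<dots> = (\<Sum>k=0..card A. (card A choose k) * f k)"
    using n_subsets[OF assms] by (intro sum.cong) auto
  finally show ?thesis .
qed

text \<open>A subset of a disjoint union is determined by its two traces, which can be chosen
  independently. This separates the part of a block after \<open>i\<close> from the part before
  it.\<close>

lemma sum_Pow_Un:
  assumes "A \<inter> B = {}"
  shows "(\<Sum>X\<in>Pow (A \<union> B). f X) = (\<Sum>X\<in>Pow A. \<Sum>Y\<in>Pow B. f (X \<union> Y))"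
  unfolding sum.cartesian_product
proof (rule sum.reindex_bij_witness[where i = "\<lambda>(X, Y). X \<union> Y"
      and j = "\<lambda>X. (X \<inter> A, X \<inter> B)"], goal_cases)
  case (5 X)
  then have "X \<inter> A \<union> X \<inter> B = X" by auto
  then show ?case by simp
qed (use assms in auto)

text \<open>A pair holds what two distinct blocks contain besides \<open>i\<close> and
  \<open>j\<close>. Elements in neither component go to other blocks, so the pairs are counted by
  trinomial coefficients.\<close>

definition disjoint_pairs :: "'a set \<Rightarrow> ('a set \<times> 'a set) set" where
  "disjoint_pairs A = {(X, Y). X \<subseteq> A \<and> Y \<subseteq> A \<and> X \<inter> Y = {}}"

lemma disjoint_pairs_eq_Sigma: "disjoint_pairs A = Sigma (Pow A) (\<lambda>X. Pow (A - X))"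
  by (auto simp: disjoint_pairs_def)

lemma finite_disjoint_pairs: "finite A \<Longrightarrow> finite (disjoint_pairs A)"
  by (simp add: disjoint_pairs_eq_Sigma)

text \<open>Each element independently joins the first component, the second or neither, so the
  choices on \<open>A\<close> and on \<open>B\<close> do not interact.\<close>

lemma sum_disjoint_pairs_Un:
  assumes "A \<inter> B = {}"
  shows "(\<Sum>(X, Y)\<in>disjoint_pairs (A \<union> B). f X Y)
    = (\<Sum>(X, Y)\<in>disjoint_pairs A. \<Sum>(X', Y')\<in>disjoint_pairs B. f (X \<union> X') (Y \<union> Y'))"
proof -
  have "(\<Sum>(X, Y)\<in>disjoint_pairs (A \<union> B). f X Y)
    = (\<Sum>((X, Y), (X', Y'))\<in>disjoint_pairs A \<times> disjoint_pairs B. f (X \<union> X') (Y \<union> Y'))"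
  proof (rule sum.reindex_bij_witness[where i = "\<lambda>((X, Y), (X', Y')). (X \<union> X', Y \<union> Y')"
        and j = "\<lambda>(X, Y). ((X \<inter> A, Y \<inter> A), (X \<inter> B, Y \<inter> B))"], goal_cases)
    case (1 z)
    then show ?case by (auto simp: disjoint_pairs_def)
  next
    case (2 z)
    then show ?case by (auto simp: disjoint_pairs_def)
  next
    case (3 w)
    then show ?case using assms by (auto simp: disjoint_pairs_def)
  next
    case (4 w)
    then show ?case using assms by (auto simp: disjoint_pairs_def)
  next
    case (5 z)
    then obtain X Y where z: "z = (X, Y)" "X \<subseteq> A \<union> B" "Y \<subseteq> A \<union> B"
      by (auto simp: disjoint_pairs_def)
    then have "X \<inter> A \<union> X \<inter> B = X" "Y \<inter> A \<union> Y \<inter> B = Y" by auto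
    then show ?case by (simp add: z(1))
  qed
  then show ?thesis by (simp add: sum.cartesian_product case_prod_unfold)
qed

text \<open>The first component is chosen from \<open>A\<close>, the second from what is left; the
  two binomial coefficients multiply to the trinomial one.\<close>

lemma sum_disjoint_pairs_card:
  fixes f :: "nat \<Rightarrow> nat \<Rightarrow> nat"
  assumes "finite A"
  shows "(\<Sum>(X, Y)\<in>disjoint_pairs A. f (card X) (card Y))
    = (\<Sum>(p, q)\<in>pairs_le (int (card A)). trinomial (card A) p q * f p q)"
proof -
  let ?m = "card A"
  have "(\<Sum>(X, Y)\<in>disjoint_pairs A. f (card X) (card Y))
      = (\<Sum>X\<in>Pow A. \<Sum>Y\<in>Pow (A - X). f (card X) (card Y))"
    unfolding disjoint_pairs_eq_Sigma using assms by (subst sum.Sigma) auto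
  also have "\<dots> = (\<Sum>X\<in>Pow A. \<Sum>q=0..?m - card X. (?m - card X choose q) * f (card X) q)"
  proof (rule sum.cong[OF refl])
    fix X assume "X \<in> Pow A"
    then have "finite X" "card (A - X) = ?m - card X"
      using assms by (auto simp: card_Diff_subset finite_subset)
    then show "(\<Sum>Y\<in>Pow (A - X). f (card X) (card Y))
        = (\<Sum>q=0..?m - card X. (?m - card X choose q) * f (card X) q)"
      using sum_Pow_card[of "A - X" "f (card X)"] assms by simp
  qed
  also have "\<dots> = (\<Sum>p=0..?m. (?m choose p) * (\<Sum>q=0..?m - p. (?m - p choose q) * f p q))"
    by (rule sum_Pow_card[OF assms])
  also have "\<dots> = (\<Sum>p=0..?m. \<Sum>q=0..?m - p. trinomial ?m p q * f p q)"
    by (auto simp: sum_distrib_left trinomial_eq_binomials mult.assoc intro!: sum.cong)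
  also have "\<dots> = (\<Sum>(p, q)\<in>Sigma {0..?m} (\<lambda>p. {0..?m - p}). trinomial ?m p q * f p q)"
    by (subst sum.Sigma) auto
  \<comment> \<open>Since \<open>p\<close> is at most \<open>?m\<close>, the truncated bound on
    \<open>q\<close> says exactly \<open>p + q \<le> ?m\<close>.\<close>
  also have "Sigma {0..?m} (\<lambda>p. {0..?m - p}) = pairs_le (int ?m)"
    by (auto simp: pairs_le_def)
  finally show ?thesis .
qed

section \<open>Partitions with prescribed blocks\<close>

text \<open>\<open>Bell\<close> speaks only of \<open>{1..m}\<close>, so partitions are transported
  along a bijection. Equality comes from an injection in each direction, hence the two arbitrary
  types in \<open>le\<close>.\<close>

lemma card_partitions:
  assumes "finite A"
  shows "card {P. partition_on A P} = Bell (card A)"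
proof -
  have le: "card {P. partition_on A P} \<le> card {P. partition_on B P}"
    if fin: "finite B" and h: "bij_betw h A B" for h and A :: "'b set" and B :: "'c set"
  proof (rule card_inj_on_le)
    have inj: "inj_on h A" using h by (simp add: bij_betw_def)
    have sub: "{P. partition_on A P} \<subseteq> Pow (Pow A)" by (auto simp: partition_on_def)
    show "inj_on ((`) ((`) h)) {P. partition_on A P}"
      by (rule inj_on_subset[OF _ sub]) (intro inj_on_image_Pow inj)
    show "finite {P. partition_on B P}" by (rule finitely_many_partition_on[OF fin])
    show "(`) ((`) h) ` {P. partition_on A P} \<subseteq> {P. partition_on B P}"
    proof safe
      fix P assume P: "partition_on A P"
      \<comment> \<open>The image partition in \<open>partition_on_inj_image\<close> has empty sets
        removed; there are none, because blocks are nonempty.\<close>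
      have "(`) h ` P - {{}} = (`) h ` P" using partition_onD3[OF P] by auto
      then show "partition_on B ((`) h ` P)"
        using partition_on_inj_image[OF P inj] h by (simp add: bij_betw_def)
    qed
  qed
  obtain h where h: "bij_betw h {1..card A} A"
    using assms by (metis ex_bij_betw_nat_finite_1)
  show ?thesis unfolding Bell_def
    by (rule antisym[OF le[OF _ bij_betw_inv_into[OF h]] le[OF assms h]]) simp
qed

lemma partition_block_unique:
  "\<lbrakk>partition_on A P; X \<in> P; Y \<in> P; x \<in> X; x \<in> Y\<rbrakk> \<Longrightarrow> X = Y"
  by (meson disjnt_iff pairwiseD partition_onD2)

text \<open>A nonempty \<open>X\<close> cannot be a block of a partition of \<open>A - X\<close>, so
  the insertion is undone by deleting \<open>X\<close>.\<close>

lemma inj_on_insert_block: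
  assumes "X \<noteq> {}"
  shows "inj_on (insert X) {Q. partition_on (A - X) Q}"
proof -
  have "X \<notin> Q" if "partition_on (A - X) Q" for Q
    using partition_onD1[OF that] assms by auto
  then show ?thesis by (intro inj_onI) (metis insert_ident mem_Collect_eq)
qed

text \<open>Deleting the block \<open>X\<close> leaves a partition of the remaining elements, and
  putting it back recovers the original.\<close>

lemma partitions_with_block_eq_image:
  assumes "X \<subseteq> A" "X \<noteq> {}"
  shows "{P. partition_on A P \<and> X \<in> P} = insert X ` {Q. partition_on (A - X) Q}"
proof safe
  fix P assume P: "partition_on A P" "X \<in> P"
  have "disjnt X (\<Union>(P - {X}))"
    using partition_block_unique[OF P(1)] P(2) by (auto simp: disjnt_iff)
  from partition_on_insert[OF this, of A] have "partition_on (A - X) (P - {X})"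
    using P by (simp add: insert_absorb)
  then show "P \<in> insert X ` {Q. partition_on (A - X) Q}"
    using P(2) by (intro image_eqI[of _ _ "P - {X}"]) auto
next
  fix Q assume Q: "partition_on (A - X) Q"
  have "disjnt X (\<Union>Q)" using partition_onD1[OF Q] by (auto simp: disjnt_iff)
  then show "partition_on A (insert X Q)" using Q assms by (simp add: partition_on_insert)
qed

lemma card_partitions_with_block:
  assumes "finite A" "X \<subseteq> A" "X \<noteq> {}"
  shows "card {P. partition_on A P \<and> X \<in> P} = Bell (card A - card X)"
  using assms
  by (simp add: partitions_with_block_eq_image card_image[OF inj_on_insert_block] card_partitions
      card_Diff_subset finite_subset)

text \<open>After \<open>X\<close> is split off, \<open>Y\<close> is a prescribed block of a
  partition of \<open>A - X\<close>, and the count for a single block applies.\<close>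

lemma card_partitions_with_two_blocks:
  assumes "finite A" "X \<subseteq> A" "Y \<subseteq> A" "X \<noteq> {}" "Y \<noteq> {}" "X \<inter> Y = {}"
  shows "card {P. partition_on A P \<and> X \<in> P \<and> Y \<in> P} = Bell (card A - card X - card Y)"
proof -
  have "X \<noteq> Y" using assms by auto
  have "{P. partition_on A P \<and> X \<in> P \<and> Y \<in> P} = {P. partition_on A P \<and> X \<in> P} \<inter> {P. Y \<in> P}"
    by auto
  \<comment> \<open>As \<open>X \<noteq> Y\<close>, the block \<open>Y\<close> of
    \<open>insert X Q\<close> must already belong to \<open>Q\<close>.\<close>
  also have "\<dots> = insert X ` {Q. partition_on (A - X) Q \<and> Y \<in> Q}"
    using \<open>X \<noteq> Y\<close> by (auto simp: partitions_with_block_eq_image[OF assms(2,4)])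
  finally have eq: "{P. partition_on A P \<and> X \<in> P \<and> Y \<in> P}
      = insert X ` {Q. partition_on (A - X) Q \<and> Y \<in> Q}" .
  have "inj_on (insert X) {Q. partition_on (A - X) Q \<and> Y \<in> Q}"
    by (rule inj_on_subset[OF inj_on_insert_block[OF assms(4)]]) auto
  moreover have "card {Q. partition_on (A - X) Q \<and> Y \<in> Q} = Bell (card (A - X) - card Y)"
    using assms by (intro card_partitions_with_block) auto
  ultimately show ?thesis
    using assms by (simp add: eq card_image card_Diff_subset finite_subset)
qed

section \<open>Sums over partitions, grouped by the blocks of given elements\<close>

text \<open>Taking the union of all members that contain \<open>x\<close> gives a total function:
  the block of \<open>x\<close> in a partition of \<open>A\<close> if \<open>x\<close> is in
  \<open>A\<close>, and the empty set otherwise.\<close>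

definition block_of :: "'a set set \<Rightarrow> 'a \<Rightarrow> 'a set" where
  "block_of P x = {y. \<exists>X\<in>P. x \<in> X \<and> y \<in> X}"

lemma block_of_eq:
  assumes "partition_on A P" "X \<in> P" "x \<in> X"
  shows "block_of P x = X"
proof -
  have "Y = X" if "Y \<in> P" "x \<in> Y" for Y
    using partition_block_unique[OF assms(1) that(1) assms(2) that(2) assms(3)] .
  then show ?thesis unfolding block_of_def using assms by blast
qed

lemma block_of_in:
  assumes "partition_on A P" "x \<in> A"
  shows "block_of P x \<in> P" "x \<in> block_of P x" "block_of P x \<subseteq> A"
proof -
  obtain X where "X \<in> P" "x \<in> X" using assms partition_onD1[OF assms(1)] by auto
  moreover from this have "block_of P x = X" by (rule block_of_eq[OF assms(1)])
  ultimately show "block_of P x \<in> P" "x \<in> block_of P x" "block_of P x \<subseteq> A"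
    using partition_onD1[OF assms(1)] by auto
qed

text \<open>Sharing a block becomes an equation between blocks, so symmetry and transitivity come
  for free.\<close>

lemma block_of_mem_iff:
  assumes "partition_on A P" "x \<in> A"
  shows "y \<in> block_of P x \<longleftrightarrow> y \<in> A \<and> block_of P y = block_of P x"
proof
  assume "y \<in> block_of P x"
  then show "y \<in> A \<and> block_of P y = block_of P x"
    using block_of_in(3)[OF assms] block_of_eq[OF assms(1) block_of_in(1)[OF assms]] by blast
next
  assume "y \<in> A \<and> block_of P y = block_of P x"
  then show "y \<in> block_of P x" using block_of_in(2)[OF assms(1), of y] by metis
qed

text \<open>Partitions are grouped by the block of \<open>i\<close>. It is indexed by its elements
  other than \<open>i\<close>, which form an arbitrary subset; the \<open>- 1\<close> in the Bell
  number accounts for \<open>i\<close>.\<close>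

lemma sum_partitions_by_block:
  fixes g :: "'a set \<Rightarrow> nat"
  assumes "finite A" "i \<in> A"
  shows "(\<Sum>P | partition_on A P. g (block_of P i))
    = (\<Sum>X\<in>Pow (A - {i}). Bell (card A - card X - 1) * g (insert i X))"
proof -
  have "(\<Sum>P | partition_on A P. g (block_of P i)) = (\<Sum>X\<in>Pow (A - {i}).
      \<Sum>P\<in>{P. P \<in> {P. partition_on A P} \<and> block_of P i - {i} = X}. g (block_of P i))"
    using assms block_of_in(3)[OF _ assms(2)]
    by (intro sum.group[symmetric]) (auto simp: finitely_many_partition_on)
  also have "\<dots> = (\<Sum>X\<in>Pow (A - {i}). Bell (card A - card X - 1) * g (insert i X))"
  proof (rule sum.cong[OF refl])
    fix X assume X: "X \<in> Pow (A - {i})"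
    then have fX: "finite X" and iX: "i \<notin> X" using assms(1) by (auto intro: finite_subset)
    have *: "block_of P i - {i} = X \<longleftrightarrow> block_of P i = insert i X" if "partition_on A P" for P
      using block_of_in(2)[OF that assms(2)] iX by blast
    \<comment> \<open>A set containing \<open>i\<close> is the block of \<open>i\<close> exactly if
      it is a block at all, which reduces the fibre to a prescribed-block count.\<close>
    have "block_of P i = insert i X \<longleftrightarrow> insert i X \<in> P" if "partition_on A P" for P
      using block_of_in(1)[OF that assms(2)] block_of_eq[OF that] by auto
    with * have eq: "{P. P \<in> {P. partition_on A P} \<and> block_of P i - {i} = X}
        = {P. partition_on A P \<and> insert i X \<in> P}" by auto
    have "(\<Sum>P\<in>{P. P \<in> {P. partition_on A P} \<and> block_of P i - {i} = X}. g (block_of P i))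
        = (\<Sum>P\<in>{P. partition_on A P \<and> insert i X \<in> P}. g (insert i X))"
      unfolding eq by (rule sum.cong[OF refl]) (auto dest: block_of_eq)
    then show "(\<Sum>P\<in>{P. P \<in> {P. partition_on A P} \<and> block_of P i - {i} = X}. g (block_of P i))
        = Bell (card A - card X - 1) * g (insert i X)"
      using card_partitions_with_block[of A "insert i X"] assms X fX iX by auto
  qed
  finally show ?thesis .
qed

text \<open>Here the fibres fix the blocks of both \<open>i\<close> and \<open>j\<close>. The weight
  sees only the first; the second enters through the Bell number and is the source of
  \<open>q\<close>, \<open>s\<close>, \<open>u\<close> in the formula. The \<open>- 2\<close>
  accounts for \<open>i\<close> and \<open>j\<close>.\<close>

lemma sum_partitions_by_two_blocks:
  fixes g :: "'a set \<Rightarrow> nat"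
  assumes "finite A" "i \<in> A" "j \<in> A" "i \<noteq> j"
  shows "(\<Sum>P | partition_on A P \<and> j \<notin> block_of P i. g (block_of P i))
    = (\<Sum>(X, Y)\<in>disjoint_pairs (A - {i, j}).
        Bell (card A - card X - card Y - 2) * g (insert i X))"
proof -
  let ?S = "{P. partition_on A P \<and> j \<notin> block_of P i}"
  let ?h = "\<lambda>P. (block_of P i - {i}, block_of P j - {j})"
  have h: "?h P \<in> disjoint_pairs (A - {i, j})" if "P \<in> ?S" for P
  proof -
    have P: "partition_on A P" and j: "j \<notin> block_of P i" using that by auto
    \<comment> \<open>Distinct blocks of a partition are disjoint, so the two remainders form a
      disjoint pair.\<close>
    have "block_of P i \<noteq> block_of P j" using block_of_in(2)[OF P assms(3)] j by auto
    then have "block_of P i \<inter> block_of P j = {}"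
      using block_of_mem_iff[OF P assms(2)] block_of_mem_iff[OF P assms(3)]
      by (metis disjoint_iff)
    then show ?thesis
      using block_of_in[OF P assms(2)] block_of_in[OF P assms(3)] by (auto simp: disjoint_pairs_def)
  qed
  have fS: "finite ?S"
    by (rule finite_subset[OF _ finitely_many_partition_on[OF assms(1)]]) auto
  have "(\<Sum>P\<in>?S. g (block_of P i))
      = (\<Sum>z\<in>disjoint_pairs (A - {i, j}). \<Sum>P\<in>{P. P \<in> ?S \<and> ?h P = z}. g (block_of P i))"
    using assms fS h by (intro sum.group[symmetric]) (auto simp: finite_disjoint_pairs)
  also have "\<dots> = (\<Sum>(X, Y)\<in>disjoint_pairs (A - {i, j}).
      Bell (card A - card X - card Y - 2) * g (insert i X))"
  proof (rule sum.cong[OF refl], clarify)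
    fix X Y assume "(X, Y) \<in> disjoint_pairs (A - {i, j})"
    then have XY: "X \<subseteq> A - {i, j}" "Y \<subseteq> A - {i, j}" "X \<inter> Y = {}"
      by (auto simp: disjoint_pairs_def)
    have fin: "finite X" "finite Y" using XY assms(1) by (auto intro: finite_subset)
    have eq: "{P. P \<in> ?S \<and> ?h P = (X, Y)}
        = {P. partition_on A P \<and> insert i X \<in> P \<and> insert j Y \<in> P}"
    proof (intro Collect_cong iffI)
      fix P assume P: "P \<in> ?S \<and> ?h P = (X, Y)"
      then have "block_of P i = insert i X" "block_of P j = insert j Y"
        using block_of_in(2)[of A P i] block_of_in(2)[of A P j] assms by auto
      then show "partition_on A P \<and> insert i X \<in> P \<and> insert j Y \<in> P"
        using P block_of_in(1)[of A P i] block_of_in(1)[of A P j] assms by auto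
    next
      fix P assume P: "partition_on A P \<and> insert i X \<in> P \<and> insert j Y \<in> P"
      then have "block_of P i = insert i X" "block_of P j = insert j Y"
        using block_of_eq[of A P] by auto
      then show "P \<in> ?S \<and> ?h P = (X, Y)" using P XY assms(4) by auto
    qed
    have "(\<Sum>P\<in>{P. P \<in> ?S \<and> ?h P = (X, Y)}. g (block_of P i))
        = (\<Sum>P\<in>{P. partition_on A P \<and> insert i X \<in> P \<and> insert j Y \<in> P}. g (insert i X))"
      unfolding eq by (rule sum.cong[OF refl]) (auto dest: block_of_eq)
    also have "\<dots> = Bell (card A - card (insert i X) - card (insert j Y)) * g (insert i X)"
      using card_partitions_with_two_blocks[of A "insert i X" "insert j Y"] assms XY by auto
    also have "card (insert i X) = card X + 1" using XY fin by (simp add: subset_Diff_insert)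
    also have "card (insert j Y) = card Y + 1" using XY fin by (simp add: subset_Diff_insert)
    also have "card A - (card X + 1) - (card Y + 1) = card A - card X - card Y - 2" by simp
    finally show "(\<Sum>P\<in>{P. P \<in> ?S \<and> ?h P = (X, Y)}. g (block_of P i))
        = Bell (card A - card X - card Y - 2) * g (insert i X)" .
  qed
  finally show ?thesis .
qed

section \<open>Decomposition of the avoiders\<close>

text \<open>\<open>X\<close> stands for the block of \<open>i\<close>. Before \<open>i\<close> the
  color \<open>b\<close> is harmless, as no \<open>a\<close> precedes it. After \<open>i\<close> and
  outside \<open>X\<close>, the color \<open>a\<close> is excluded by the case and \<open>b\<close>
  by avoidance.\<close>

definition colors_one_block :: "nat \<Rightarrow> nat \<Rightarrow> nat \<Rightarrow> nat \<Rightarrow> nat set \<Rightarrow> nat \<Rightarrow> nat set" where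
  "colors_one_block c a b i X x =
    (if x < i then {1..c} - {a} else if x = i then {a}
     else if x \<in> X then {1..c} else {1..c} - {a, b})"

text \<open>Before \<open>j\<close> the rules are those of the other case, because \<open>j\<close>
  is the first element of color \<open>a\<close> outside \<open>X\<close>. After \<open>j\<close>
  the color \<open>a\<close> is free again.\<close>

definition colors_two_blocks ::
  "nat \<Rightarrow> nat \<Rightarrow> nat \<Rightarrow> nat \<Rightarrow> nat \<Rightarrow> nat set \<Rightarrow> nat \<Rightarrow> nat set" where
  "colors_two_blocks c a b i j X x =
    (if x < j then colors_one_block c a b i X x else if x = j then {a} else {1..c} - {b})"

text \<open>The three classes are given as products over positions, fibred over partitions, so that
  their cardinalities are sums of products of color counts.\<close>

definition avoiders_no_a :: "nat \<Rightarrow> nat \<Rightarrow> nat \<Rightarrow> (nat set set \<times> (nat \<Rightarrow> nat)) set" where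
  "avoiders_no_a n c a = {P. partition_on {1..n} P} \<times> ({1..n} \<rightarrow>\<^sub>E ({1..c} - {a}))"

definition avoiders_one_block ::
  "nat \<Rightarrow> nat \<Rightarrow> nat \<Rightarrow> nat \<Rightarrow> nat \<Rightarrow> (nat set set \<times> (nat \<Rightarrow> nat)) set" where
  "avoiders_one_block n c a b i =
    Sigma {P. partition_on {1..n} P} (\<lambda>P. PiE {1..n} (colors_one_block c a b i (block_of P i)))"

definition avoiders_two_blocks ::
  "nat \<Rightarrow> nat \<Rightarrow> nat \<Rightarrow> nat \<Rightarrow> nat \<Rightarrow> nat \<Rightarrow> (nat set set \<times> (nat \<Rightarrow> nat)) set" where
  "avoiders_two_blocks n c a b i j =
    Sigma {P. partition_on {1..n} P \<and> j \<notin> block_of P i}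
      (\<lambda>P. PiE {1..n} (colors_two_blocks c a b i j (block_of P i)))"

lemma eq_contains_12_iff:
  assumes P: "partition_on {1..n} P"
  shows "eq_contains_12 a b (P, col) \<longleftrightarrow> (\<exists>x\<in>{1..n}. \<exists>y\<in>{1..n}. x < y \<and> col x = a \<and> col y = b
    \<and> block_of P x \<noteq> block_of P y)"
proof
  assume "eq_contains_12 a b (P, col)"
  then obtain X Y x y where *: "X \<in> P" "Y \<in> P" "X \<noteq> Y" "x \<in> X" "y \<in> Y"
      "x < y" "col x = a" "col y = b"
    unfolding eq_contains_12_def by auto
  have "x \<in> {1..n}" "y \<in> {1..n}" unfolding partition_onD1[OF P] using * by auto
  moreover have "block_of P x \<noteq> block_of P y"
    using * by (simp only: block_of_eq[OF P \<open>X \<in> P\<close> \<open>x \<in> X\<close>] block_of_eq[OF P \<open>Y \<in> P\<close> \<open>y \<in> Y\<close>]) simp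
  ultimately show "\<exists>x\<in>{1..n}. \<exists>y\<in>{1..n}. x < y \<and> col x = a \<and> col y = b
      \<and> block_of P x \<noteq> block_of P y"
    using *(6-8) by blast
next
  assume "\<exists>x\<in>{1..n}. \<exists>y\<in>{1..n}. x < y \<and> col x = a \<and> col y = b
      \<and> block_of P x \<noteq> block_of P y"
  then obtain x y where "x \<in> {1..n}" "y \<in> {1..n}" "x < y" "col x = a" "col y = b"
      "block_of P x \<noteq> block_of P y"
    by blast
  then show "eq_contains_12 a b (P, col)"
    unfolding eq_contains_12_def prod.case
    using block_of_in(1,2)[OF P \<open>x \<in> {1..n}\<close>] block_of_in(1,2)[OF P \<open>y \<in> {1..n}\<close>]
    by (intro bexI[of _ "block_of P x"] bexI[of _ "block_of P y"] conjI bexI[of _ x] bexI[of _ y])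
qed

lemma eq_avoiders_12_iff:
  "(P, col) \<in> eq_avoiders_12 n c a b \<longleftrightarrow> partition_on {1..n} P \<and> col \<in> {1..n} \<rightarrow>\<^sub>E {1..c} \<and>
    (\<forall>x\<in>{1..n}. \<forall>y\<in>{1..n}. x < y \<and> col x = a \<and> col y = b \<longrightarrow> block_of P x = block_of P y)"
proof (cases "partition_on {1..n} P")
  case True
  have "\<not> eq_contains_12 a b (P, col) \<longleftrightarrow> (\<forall>x\<in>{1..n}. \<forall>y\<in>{1..n}.
      x < y \<and> col x = a \<and> col y = b \<longrightarrow> block_of P x = block_of P y)"
    unfolding eq_contains_12_iff[OF True] by blast
  with True show ?thesis
    unfolding eq_avoiders_12_def colored_partitions_def mem_Collect_eq mem_Sigma_iff by argo
qed (simp add: eq_avoiders_12_def colored_partitions_def)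

text \<open>A conjunction of implications, unlike nested conditionals, can be distributed over all
  positions; each conjunct then becomes one condition on the coloring.\<close>

lemma mem_colors_one_block_iff:
  assumes "a \<in> {1..c}"
  shows "y \<in> colors_one_block c a b i X x \<longleftrightarrow> y \<in> {1..c} \<and> (x = i \<longrightarrow> y = a) \<and>
    (x < i \<longrightarrow> y \<noteq> a) \<and> (i < x \<and> x \<notin> X \<longrightarrow> y \<noteq> a \<and> y \<noteq> b)"
  using assms by (cases x i rule: linorder_cases) (auto simp: colors_one_block_def)

lemma mem_colors_two_blocks_iff:
  assumes "a \<in> {1..c}" "i < j"
  shows "y \<in> colors_two_blocks c a b i j X x \<longleftrightarrow> y \<in> {1..c} \<and> (x = i \<longrightarrow> y = a) \<and>
    (x = j \<longrightarrow> y = a) \<and> (x < i \<longrightarrow> y \<noteq> a) \<and>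
    (i < x \<and> x < j \<and> x \<notin> X \<longrightarrow> y \<noteq> a \<and> y \<noteq> b) \<and> (j < x \<longrightarrow> y \<noteq> b)"
  using assms by (cases x j rule: linorder_cases)
    (auto simp: colors_two_blocks_def mem_colors_one_block_iff)

lemma avoiders_one_block_iff:
  assumes "i \<in> {1..n}" "a \<in> {1..c}"
  shows "(P, col) \<in> avoiders_one_block n c a b i \<longleftrightarrow>
    partition_on {1..n} P \<and> col \<in> {1..n} \<rightarrow>\<^sub>E {1..c} \<and> col i = a \<and>
    (\<forall>x\<in>{1..n}. x < i \<longrightarrow> col x \<noteq> a) \<and>
    (\<forall>x\<in>{1..n}. i < x \<and> x \<notin> block_of P i \<longrightarrow> col x \<noteq> a \<and> col x \<noteq> b)"
proof -
  have "(\<forall>x\<in>{1..n}. x = i \<longrightarrow> col x = a) \<longleftrightarrow> col i = a" using assms by auto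
  then show ?thesis unfolding avoiders_one_block_def PiE_iff mem_Sigma_iff
      mem_colors_one_block_iff[OF assms(2)] ball_conj_distrib mem_Collect_eq by argo
qed

lemma avoiders_two_blocks_iff:
  assumes "i \<in> {1..n}" "j \<in> {i<..n}" "a \<in> {1..c}"
  shows "(P, col) \<in> avoiders_two_blocks n c a b i j \<longleftrightarrow>
    partition_on {1..n} P \<and> j \<notin> block_of P i \<and> col \<in> {1..n} \<rightarrow>\<^sub>E {1..c} \<and> col i = a \<and> col j = a \<and>
    (\<forall>x\<in>{1..n}. x < i \<longrightarrow> col x \<noteq> a) \<and>
    (\<forall>x\<in>{1..n}. i < x \<and> x < j \<and> x \<notin> block_of P i \<longrightarrow> col x \<noteq> a \<and> col x \<noteq> b) \<and>
    (\<forall>x\<in>{1..n}. j < x \<longrightarrow> col x \<noteq> b)"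
proof -
  have "(\<forall>x\<in>{1..n}. x = i \<longrightarrow> col x = a) \<longleftrightarrow> col i = a"
    "(\<forall>x\<in>{1..n}. x = j \<longrightarrow> col x = a) \<longleftrightarrow> col j = a" using assms by auto
  moreover have "i < j" using assms by simp
  ultimately show ?thesis unfolding avoiders_two_blocks_def PiE_iff mem_Sigma_iff
      mem_colors_two_blocks_iff[OF assms(3) \<open>i < j\<close>] ball_conj_distrib mem_Collect_eq
    by argo
qed

lemma avoiders_no_a_iff:
  "(P, col) \<in> avoiders_no_a n c a \<longleftrightarrow>
    partition_on {1..n} P \<and> col \<in> {1..n} \<rightarrow>\<^sub>E {1..c} \<and> (\<forall>x\<in>{1..n}. col x \<noteq> a)"
  unfolding avoiders_no_a_def by (auto simp: PiE_iff)

section \<open>The three classes cover exactly the avoiders\<close>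

text \<open>Exhaustiveness: outside the first class the index \<open>i\<close> exists, and outside
  the second class so does \<open>j\<close>.\<close>

lemma eq_avoiders_12_two_blocks_remaining:
  assumes "a \<in> {1..c}" and av: "(P, col) \<in> eq_avoiders_12 n c a b"
    and no_a: "(P, col) \<notin> avoiders_no_a n c a"
    and one: "\<And>i. i \<in> {1..n} \<Longrightarrow> (P, col) \<notin> avoiders_one_block n c a b i"
  shows "\<exists>i\<in>{1..n}. \<exists>j\<in>{i<..n}. (P, col) \<in> avoiders_two_blocks n c a b i j"
proof -
  have P: "partition_on {1..n} P" and col: "col \<in> {1..n} \<rightarrow>\<^sub>E {1..c}"
    and same: "\<And>x y. \<lbrakk>x \<in> {1..n}; y \<in> {1..n}; x < y; col x = a; col y = b\<rbrakk>
      \<Longrightarrow> block_of P x = block_of P y"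
    using av unfolding eq_avoiders_12_iff by blast+
  have same': "y \<in> block_of P x"
    if "x \<in> {1..n}" "y \<in> {1..n}" "x < y" "col x = a" "col y = b" for x y
    using same[OF that] block_of_in(2)[OF P that(2)] by simp
  define i where "i = (LEAST x. x \<in> {1..n} \<and> col x = a)"
  have "\<exists>x. x \<in> {1..n} \<and> col x = a"
    using no_a P col unfolding avoiders_no_a_iff by blast
  then have i: "i \<in> {1..n}" "col i = a"
    unfolding i_def by (metis (mono_tags, lifting) LeastI_ex)+
  have i_least: "col x \<noteq> a" if "x \<in> {1..n}" "x < i" for x
    using that not_less_Least[of x] unfolding i_def by blast
  define j where "j = (LEAST x. x \<in> {1..n} \<and> col x = a \<and> x \<notin> block_of P i)"
  have "\<exists>x. x \<in> {1..n} \<and> col x = a \<and> x \<notin> block_of P i"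
  \<comment> \<open>If every \<open>a\<close> lies in the block of \<open>i\<close>, avoidance puts
    every later \<open>b\<close> there too, which is the one-block class.\<close>
  proof (rule ccontr)
    assume "\<nexists>x. x \<in> {1..n} \<and> col x = a \<and> x \<notin> block_of P i"
    then have "(P, col) \<in> avoiders_one_block n c a b i"
      unfolding avoiders_one_block_iff[OF i(1) assms(1)]
      using P col i i_least same'[OF i(1)] by blast
    with one[OF i(1)] show False by contradiction
  qed
  then have j: "j \<in> {1..n}" "col j = a" "j \<notin> block_of P i"
    unfolding j_def by (metis (mono_tags, lifting) LeastI_ex)+
  have j_least: "col x \<noteq> a" if "x \<in> {1..n}" "x < j" "x \<notin> block_of P i" for x
    using that not_less_Least[of x] unfolding j_def by blast
  \<comment> \<open>\<open>i\<close> lies in its own block and \<open>j\<close> does not; minimality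
    of \<open>i\<close> then settles the order.\<close>
  have "i \<noteq> j" using block_of_in(2)[OF P i(1)] j(3) by auto
  then have ij: "i < j" using i_least[OF j(1)] j(2) by force
  have no_b: "col x \<noteq> b" if x: "x \<in> {1..n}" "j < x" for x
  proof
    assume "col x = b"
    then have "block_of P i = block_of P x" "block_of P j = block_of P x"
      using same i j x ij by auto
    then show False using block_of_in(2)[OF P j(1)] j(3) by simp
  qed
  have "j \<in> {i<..n}" using ij j by simp
  then have "(P, col) \<in> avoiders_two_blocks n c a b i j"
    using P col i j i_least j_least no_b same'[OF i(1)]
    by (subst avoiders_two_blocks_iff[OF i(1) _ assms(1)]) blast+
  with i(1) \<open>j \<in> {i<..n}\<close> show ?thesis by blast
qed

lemma avoiders_no_a_subset: "avoiders_no_a n c a \<subseteq> eq_avoiders_12 n c a b"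
  by (rule subrelI) (unfold avoiders_no_a_iff eq_avoiders_12_iff, blast)

text \<open>If \<open>x < y\<close> have colors \<open>a\<close> and \<open>b\<close>, then
  \<open>i \<le> x\<close>. Both elements are \<open>i\<close> itself or later ones of color
  \<open>a\<close> or \<open>b\<close>, so both lie in the block of \<open>i\<close>.\<close>

lemma avoiders_one_block_subset:
  assumes "i \<in> {1..n}" "a \<in> {1..c}" "a \<noteq> b"
  shows "avoiders_one_block n c a b i \<subseteq> eq_avoiders_12 n c a b"
proof (rule subrelI)
  fix P col assume mem: "(P, col) \<in> avoiders_one_block n c a b i"
  note iff = avoiders_one_block_iff[OF assms(1,2)]
  have P: "partition_on {1..n} P" using mem unfolding iff by blast
  have before: "\<And>x. x \<in> {1..n} \<Longrightarrow> x < i \<Longrightarrow> col x \<noteq> a"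
    and out: "\<And>x. x \<in> {1..n} \<Longrightarrow> i < x \<Longrightarrow> x \<notin> block_of P i \<Longrightarrow> col x \<noteq> a \<and> col x \<noteq> b"
    using mem unfolding iff by blast+
  have "block_of P x = block_of P y"
    if xy: "x \<in> {1..n}" "y \<in> {1..n}" "x < y" "col x = a" "col y = b" for x y
  proof -
    have "i \<le> x" using before[OF xy(1)] xy(4) by force
    then have "x \<in> block_of P i" "y \<in> block_of P i"
      using out[OF xy(1)] out[OF xy(2)] xy block_of_in(2)[OF P assms(1)] by force+
    then show ?thesis unfolding block_of_mem_iff[OF P assms(1)] by simp
  qed
  then show "(P, col) \<in> eq_avoiders_12 n c a b"
    using mem unfolding iff eq_avoiders_12_iff by blast
qed

lemma avoiders_two_blocks_subset:
  assumes "i \<in> {1..n}" "j \<in> {i<..n}" "a \<in> {1..c}" "a \<noteq> b"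
  shows "avoiders_two_blocks n c a b i j \<subseteq> eq_avoiders_12 n c a b"
proof (rule subrelI)
  fix P col assume mem: "(P, col) \<in> avoiders_two_blocks n c a b i j"
  note iff = avoiders_two_blocks_iff[OF assms(1-3)]
  have P: "partition_on {1..n} P" and j: "col j = a" using mem unfolding iff by blast+
  have before: "\<And>x. x \<in> {1..n} \<Longrightarrow> x < i \<Longrightarrow> col x \<noteq> a"
    and out: "\<And>x. x \<in> {1..n} \<Longrightarrow> i < x \<Longrightarrow> x < j \<Longrightarrow> x \<notin> block_of P i \<Longrightarrow> col x \<noteq> a \<and> col x \<noteq> b"
    and after: "\<And>x. x \<in> {1..n} \<Longrightarrow> j < x \<Longrightarrow> col x \<noteq> b"
    using mem unfolding iff by blast+
  have "block_of P x = block_of P y"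
    if xy: "x \<in> {1..n}" "y \<in> {1..n}" "x < y" "col x = a" "col y = b" for x y
  proof -
    have "i \<le> x" using before[OF xy(1)] xy(4) by force
    \<comment> \<open>No \<open>b\<close> occurs after \<open>j\<close>, and \<open>j\<close> itself
      has color \<open>a \<noteq> b\<close>. Hence \<open>y < j\<close>, and the pair lies where the
      one-block argument applies.\<close>
    moreover have "y \<noteq> j" using j xy(5) assms(4) by auto
    then have "y < j" using after[OF xy(2)] xy(5) by force
    ultimately have "x \<in> block_of P i" "y \<in> block_of P i"
      using out[OF xy(1)] out[OF xy(2)] xy block_of_in(2)[OF P assms(1)] by force+
    then show ?thesis unfolding block_of_mem_iff[OF P assms(1)] by simp
  qed
  then show "(P, col) \<in> eq_avoiders_12 n c a b"
    using mem unfolding iff eq_avoiders_12_iff by blast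
qed

lemma eq_avoiders_12_decomposition:
  assumes "a \<in> {1..c}" "a \<noteq> b"
  shows "eq_avoiders_12 n c a b = avoiders_no_a n c a
    \<union> (\<Union>i\<in>{1..n}. avoiders_one_block n c a b i)
    \<union> (\<Union>i\<in>{1..n}. \<Union>j\<in>{i<..n}. avoiders_two_blocks n c a b i j)" (is "?A = ?D")
proof
  show "?A \<subseteq> ?D"
  proof (rule subrelI)
    fix P col assume "(P, col) \<in> ?A"
    from eq_avoiders_12_two_blocks_remaining[OF assms(1) this] show "(P, col) \<in> ?D" by blast
  qed
  show "?D \<subseteq> ?A"
    using avoiders_no_a_subset avoiders_one_block_subset[OF _ assms]
      avoiders_two_blocks_subset[OF _ _ assms]
    by (intro Un_least UN_least) auto
qed

section \<open>Disjointness of the classes and the resulting sum\<close>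

lemma disjoint_avoiders_no_a_one_block:
  assumes "i \<in> {1..n}" "a \<in> {1..c}"
  shows "avoiders_no_a n c a \<inter> avoiders_one_block n c a b i = {}"
proof -
  have "(P, col) \<notin> avoiders_one_block n c a b i" if "(P, col) \<in> avoiders_no_a n c a" for P col
    using that assms(1) unfolding avoiders_no_a_iff avoiders_one_block_iff[OF assms] by blast
  then show ?thesis by auto
qed

lemma disjoint_avoiders_no_a_two_blocks:
  assumes "i \<in> {1..n}" "j \<in> {i<..n}" "a \<in> {1..c}"
  shows "avoiders_no_a n c a \<inter> avoiders_two_blocks n c a b i j = {}"
proof -
  have "(P, col) \<notin> avoiders_two_blocks n c a b i j" if "(P, col) \<in> avoiders_no_a n c a" for P col
    using that assms(1) unfolding avoiders_no_a_iff avoiders_two_blocks_iff[OF assms] by blast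
  then show ?thesis by auto
qed

text \<open>Both indices would be the least element of color \<open>a\<close>.\<close>

lemma disjoint_avoiders_one_block:
  assumes "i \<in> {1..n}" "i' \<in> {1..n}" "i \<noteq> i'" "a \<in> {1..c}"
  shows "avoiders_one_block n c a b i \<inter> avoiders_one_block n c a b i' = {}"
proof (rule ccontr)
  assume "\<not> ?thesis"
  then obtain P col where 1: "(P, col) \<in> avoiders_one_block n c a b i"
    and 2: "(P, col) \<in> avoiders_one_block n c a b i'" by force
  note 1 = 1[unfolded avoiders_one_block_iff[OF assms(1,4)]]
  note 2 = 2[unfolded avoiders_one_block_iff[OF assms(2,4)]]
  have "\<not> i < i'" using 1 2 assms(1) by blast
  moreover have "\<not> i' < i" using 1 2 assms(2) by blast
  ultimately show False using assms(3) by simp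
qed

text \<open>The index \<open>i\<close> is again forced to be the same. Then \<open>j\<close> has
  color \<open>a\<close> outside the block of \<open>i\<close>, which the one-block class rules
  out.\<close>

lemma disjoint_avoiders_one_block_two_blocks:
  assumes "i \<in> {1..n}" "i' \<in> {1..n}" "j \<in> {i'<..n}" "a \<in> {1..c}"
  shows "avoiders_one_block n c a b i \<inter> avoiders_two_blocks n c a b i' j = {}"
proof (rule ccontr)
  assume "\<not> ?thesis"
  then obtain P col where 1: "(P, col) \<in> avoiders_one_block n c a b i"
    and 2: "(P, col) \<in> avoiders_two_blocks n c a b i' j" by force
  note 1 = 1[unfolded avoiders_one_block_iff[OF assms(1,4)]]
  note 2 = 2[unfolded avoiders_two_blocks_iff[OF assms(2-4)]]
  have "\<not> i < i'" using 1 2 assms(1) by blast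
  moreover have "\<not> i' < i" using 1 2 assms(2) by blast
  ultimately have "i = i'" by simp
  moreover have "j \<in> {1..n}" "i' < j" using assms by auto
  ultimately show False using 1 2 by blast
qed

text \<open>The colored partition determines \<open>i\<close> as the least element of color
  \<open>a\<close>, and then \<open>j\<close> as the least such element outside the block of
  \<open>i\<close>.\<close>

lemma disjoint_avoiders_two_blocks:
  assumes "i \<in> {1..n}" "j \<in> {i<..n}" "i' \<in> {1..n}" "j' \<in> {i'<..n}" "(i, j) \<noteq> (i', j')"
    and "a \<in> {1..c}"
  shows "avoiders_two_blocks n c a b i j \<inter> avoiders_two_blocks n c a b i' j' = {}"
proof (rule ccontr)
  assume "\<not> ?thesis"
  then obtain P col where 1: "(P, col) \<in> avoiders_two_blocks n c a b i j"
    and 2: "(P, col) \<in> avoiders_two_blocks n c a b i' j'" by force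
  note 1 = 1[unfolded avoiders_two_blocks_iff[OF assms(1,2,6)]]
  note 2 = 2[unfolded avoiders_two_blocks_iff[OF assms(3,4,6)]]
  have "\<not> i < i'" using 1 2 assms(1) by blast
  moreover have "\<not> i' < i" using 1 2 assms(3) by blast
  ultimately have "i = i'" by simp
  have j: "j \<in> {1..n}" "i < j" "j' \<in> {1..n}" "i < j'" using assms \<open>i = i'\<close> by auto
  have "\<not> j < j'" using 1 2 j(1,2) unfolding \<open>i = i'\<close> by blast
  moreover have "\<not> j' < j" using 1 2 j(3,4) unfolding \<open>i = i'\<close> by blast
  ultimately show False using assms(5) \<open>i = i'\<close> by simp
qed

lemma finite_eq_avoiders_12: "finite (eq_avoiders_12 n c a b)"
  unfolding eq_avoiders_12_def colored_partitions_def
  by (simp add: finitely_many_partition_on finite_PiE)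

lemma card_eq_avoiders_12:
  assumes "a \<in> {1..c}" "a \<noteq> b"
  shows "card (eq_avoiders_12 n c a b) = card (avoiders_no_a n c a)
    + (\<Sum>i=1..n. card (avoiders_one_block n c a b i))
    + (\<Sum>i=1..n. \<Sum>j\<in>{i<..n}. card (avoiders_two_blocks n c a b i j))"
proof -
  let ?O = "avoiders_one_block n c a b" and ?T = "avoiders_two_blocks n c a b"
  \<comment> \<open>Indexing by pairs turns the double union into a single disjoint union.\<close>
  let ?S = "Sigma {1..n} (\<lambda>i. {i<..n})"
  note fin = finite_subset[OF _ finite_eq_avoiders_12]
  have f0: "finite (avoiders_no_a n c a)" by (rule fin[OF avoiders_no_a_subset])
  have f1: "finite (?O i)" if "i \<in> {1..n}" for i
    by (rule fin[OF avoiders_one_block_subset[OF that assms]])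
  have f2: "finite (?T i j)" if "i \<in> {1..n}" "j \<in> {i<..n}" for i j
    by (rule fin[OF avoiders_two_blocks_subset[OF that assms]])
  have eq: "eq_avoiders_12 n c a b
      = avoiders_no_a n c a \<union> (\<Union>i\<in>{1..n}. ?O i) \<union> (\<Union>z\<in>?S. ?T (fst z) (snd z))"
  proof -
    have "(\<Union>i\<in>{1..n}. \<Union>j\<in>{i<..n}. ?T i j) = (\<Union>z\<in>?S. ?T (fst z) (snd z))"
      unfolding UN_iff set_eq_iff Sigma_def by (simp del: One_nat_def)
    then show ?thesis unfolding eq_avoiders_12_decomposition[OF assms] by (simp only:)
  qed
  have f1': "finite (\<Union>i\<in>{1..n}. ?O i)" by (rule finite_UN_I[OF _ f1]) simp_all
  have S: "fst z \<in> {1..n}" "snd z \<in> {fst z<..n}" if "z \<in> ?S" for z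
    using that by auto
  have f2': "finite (\<Union>z\<in>?S. ?T (fst z) (snd z))" by (rule finite_UN_I[OF _ f2[OF S]]) simp_all
  have d01: "avoiders_no_a n c a \<inter> (\<Union>i\<in>{1..n}. ?O i) = {}"
    unfolding Int_UN_distrib
    using disjoint_avoiders_no_a_one_block[OF _ assms(1)] by (simp del: One_nat_def)
  have "avoiders_no_a n c a \<inter> (\<Union>z\<in>?S. ?T (fst z) (snd z)) = {}"
    unfolding Int_UN_distrib UNION_empty_conv
    by (intro ballI disjoint_avoiders_no_a_two_blocks[OF S assms(1)])
  moreover have "(\<Union>i\<in>{1..n}. ?O i) \<inter> (\<Union>z\<in>?S. ?T (fst z) (snd z)) = {}"
    unfolding Int_UN_distrib2 UNION_empty_conv
    by (intro ballI disjoint_avoiders_one_block_two_blocks[OF _ S assms(1)])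
  ultimately have d2: "(avoiders_no_a n c a \<union> (\<Union>i\<in>{1..n}. ?O i))
      \<inter> (\<Union>z\<in>?S. ?T (fst z) (snd z)) = {}" by blast
  have c1: "card (\<Union>i\<in>{1..n}. ?O i) = (\<Sum>i=1..n. card (?O i))"
    by (rule card_UN_disjoint) (use f1 disjoint_avoiders_one_block[OF _ _ _ assms(1)] in blast)+
  have "card (\<Union>z\<in>?S. ?T (fst z) (snd z)) = (\<Sum>z\<in>?S. card (?T (fst z) (snd z)))"
  proof (rule card_UN_disjoint)
    show "\<forall>z\<in>?S. \<forall>w\<in>?S. z \<noteq> w \<longrightarrow> ?T (fst z) (snd z) \<inter> ?T (fst w) (snd w) = {}"
      by (intro ballI impI disjoint_avoiders_two_blocks[OF S S _ assms(1)]) (simp_all add: prod_eq_iff)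
    show "\<forall>z\<in>?S. finite (?T (fst z) (snd z))" using f2[OF S] by blast
  qed simp
  also have "\<dots> = (\<Sum>i=1..n. \<Sum>j\<in>{i<..n}. card (?T i j))"
    by (subst sum.Sigma) (auto simp: case_prod_unfold)
  finally show ?thesis
    unfolding eq using c1 f0 f1' f2' d01 d2 by (simp add: card_Un_disjoint)
qed

section \<open>Cardinalities of the three classes\<close>

lemma card_avoiders_no_a:
  assumes "a \<in> {1..c}"
  shows "card (avoiders_no_a n c a) = Bell n * (c - 1) ^ n"
  using assms by (simp add: avoiders_no_a_def card_cartesian_product card_PiE Bell_def)

lemma prod_if_mem:
  fixes u v :: nat
  assumes "finite B" "K \<subseteq> B"
  shows "(\<Prod>x\<in>B. if x \<in> K then u else v) = u ^ card K * v ^ (card B - card K)"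
proof -
  have "B \<inter> {x. x \<in> K} = K" "B \<inter> - {x. x \<in> K} = B - K" "finite K"
    using assms by (auto intro: finite_subset)
  then show ?thesis using assms by (simp add: prod.If_cases card_Diff_subset)
qed

lemma card_color_sets:
  assumes "a \<in> {1..c}" "b \<in> {1..c}" "a \<noteq> b"
  shows "card ({1..c} - {a}) = c - 1" "card ({1..c} - {b}) = c - 1" "card ({1..c} - {a, b}) = c - 2"
  using assms by (simp_all add: card_Diff_subset)

text \<open>Only the part \<open>K\<close> of the block after \<open>i\<close> affects the count:
  its elements have \<open>c\<close> choices and the other later ones \<open>c - 2\<close>. Each
  position before \<open>i\<close> has \<open>c - 1\<close> choices, in the block or not.\<close>

lemma prod_card_colors_one_block:
  assumes "i \<in> {1..n}" "a \<in> {1..c}" "b \<in> {1..c}" "a \<noteq> b" "K \<subseteq> {i<..n}" "L \<subseteq> {1..<i}"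
  shows "(\<Prod>x\<in>{1..n}. card (colors_one_block c a b i (insert i (K \<union> L)) x))
    = c ^ card K * (c - 1) ^ (i - 1) * (c - 2) ^ (n - i - card K)" (is "prod ?f _ = _")
proof -
  note cards = card_color_sets[OF assms(2-4), unfolded One_nat_def]
  have "{1..n} = insert i ({1..<i} \<union> {i<..n})" using assms(1) by auto
  then have "prod ?f {1..n} = ?f i * (prod ?f {1..<i} * prod ?f {i<..n})"
    by (simp, subst prod.union_disjoint, simp, simp, force, simp)
  also have "?f i = 1" by (simp add: colors_one_block_def)
  also have "prod ?f {1..<i} = (\<Prod>x\<in>{1..<i}. c - 1)"
    by (rule prod.cong) (simp_all add: colors_one_block_def cards)
  also have "prod ?f {i<..n} = (\<Prod>x\<in>{i<..n}. if x \<in> K then c else c - 2)"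
    by (rule prod.cong) (use assms(6) in \<open>auto simp: colors_one_block_def cards(3)\<close>)
  also have "\<dots> = c ^ card K * (c - 2) ^ (n - i - card K)"
    using assms(5) by (simp add: prod_if_mem)
  finally show ?thesis by (simp add: mult_ac)
qed

text \<open>The block of \<open>i\<close> has \<open>k\<close> elements after \<open>i\<close> and
  \<open>l\<close> before it.\<close>

lemma card_avoiders_one_block:
  assumes "i \<in> {1..n}" "a \<in> {1..c}" "b \<in> {1..c}" "a \<noteq> b"
  shows "card (avoiders_one_block n c a b i) =
    (\<Sum>k=0..n - i. \<Sum>l=0..<i.
        ((n - i) choose k) * ((i - 1) choose l) * Bell (n - k - l - 1)
        * c ^ k * (c - 1) ^ (i - 1) * (c - 2) ^ (n - i - k))"
proof -
  let ?g = "\<lambda>X. \<Prod>x\<in>{1..n}. card (colors_one_block c a b i X x)"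
  let ?h = "\<lambda>k l. Bell (n - k - l - 1) * (c ^ k * (c - 1) ^ (i - 1) * (c - 2) ^ (n - i - k))"
  have finc: "finite (colors_one_block c a b i X x)" for X x
    by (simp add: colors_one_block_def)
  have "card (avoiders_one_block n c a b i) = (\<Sum>P | partition_on {1..n} P. ?g (block_of P i))"
    unfolding avoiders_one_block_def
    by (subst card_SigmaI) (auto simp: finitely_many_partition_on card_PiE finc intro!: finite_PiE)
  also have "\<dots> = (\<Sum>X\<in>Pow ({1..n} - {i}). Bell (card {1..n} - card X - 1) * ?g (insert i X))"
    by (rule sum_partitions_by_block) (use assms in auto)
  also have "{1..n} - {i} = {i<..n} \<union> {1..<i}" using assms(1) by auto
  also have "(\<Sum>X\<in>Pow ({i<..n} \<union> {1..<i}). Bell (card {1..n} - card X - 1) * ?g (insert i X))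
    = (\<Sum>K\<in>Pow {i<..n}. \<Sum>L\<in>Pow {1..<i}.
        Bell (card {1..n} - card (K \<union> L) - 1) * ?g (insert i (K \<union> L)))"
    by (rule sum_Pow_Un) auto
  also have "\<dots> = (\<Sum>K\<in>Pow {i<..n}. \<Sum>L\<in>Pow {1..<i}. ?h (card K) (card L))"
  proof (intro sum.cong refl)
    fix K L assume KL: "K \<in> Pow {i<..n}" "L \<in> Pow {1..<i}"
    then have "finite K" "finite L" by (auto intro: finite_subset)
    moreover have "K \<inter> L = {}" using KL by force
    ultimately have "card (K \<union> L) = card K + card L" by (rule card_Un_disjoint)
    then show "Bell (card {1..n} - card (K \<union> L) - 1) * ?g (insert i (K \<union> L))
        = ?h (card K) (card L)"
      using prod_card_colors_one_block[OF assms, of K L] KL by simp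
  qed
  also have "\<dots> = (\<Sum>K\<in>Pow {i<..n}. \<Sum>l=0..card {1..<i}. (card {1..<i} choose l) * ?h (card K) l)"
    by (intro sum.cong refl sum_Pow_card[where f = "?h (card _)"]) simp
  also have "\<dots> = (\<Sum>k=0..card {i<..n}. (card {i<..n} choose k)
      * (\<Sum>l=0..card {1..<i}. (card {1..<i} choose l) * ?h k l))"
    by (rule sum_Pow_card) simp
  also have "card {1..<i} = i - 1" by simp
  also have "card {i<..n} = n - i" by simp
  \<comment> \<open>This uses \<open>i \<ge> 1\<close>. The form \<open>{0..<i}\<close> is also
    right for \<open>i = 0\<close>, where it is empty while \<open>{0..i - 1}\<close> is
    not.\<close>
  also have "{0..i - 1} = {0..<i}" using assms(1) by auto
  finally show ?thesis by (simp only: sum_distrib_left mult.assoc)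
qed

text \<open>Membership in the block of \<open>i\<close> matters only strictly between
  \<open>i\<close> and \<open>j\<close>. Before \<open>i\<close> and after \<open>j\<close> there
  are \<open>c - 1\<close> choices each, lacking \<open>a\<close> and \<open>b\<close>
  respectively.\<close>

lemma prod_card_colors_two_blocks:
  assumes "i \<in> {1..n}" "j \<in> {i<..n}" "a \<in> {1..c}" "b \<in> {1..c}" "a \<noteq> b"
    and "X \<subseteq> {1..<i}" "Y \<subseteq> {i<..<j}" "Z \<subseteq> {j<..n}"
  shows "(\<Prod>x\<in>{1..n}. card (colors_two_blocks c a b i j (insert i (X \<union> (Y \<union> Z))) x))
    = c ^ card Y * (c - 1) ^ (n - j + i - 1) * (c - 2) ^ (j - i - card Y - 1)"
    (is "prod ?f _ = _")
proof -
  note cards = card_color_sets[OF assms(3-5), unfolded One_nat_def]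
  have "{1..n} = insert i (insert j ({1..<i} \<union> ({i<..<j} \<union> {j<..n})))"
    using assms(1,2) by auto
  then have "prod ?f {1..n}
      = ?f i * (?f j * (prod ?f {1..<i} * (prod ?f {i<..<j} * prod ?f {j<..n})))"
    using assms(1,2) by (simp, subst prod.union_disjoint, simp, simp, force,
        subst prod.union_disjoint, simp, simp, force, simp)
  also have "?f i = 1" using assms(2) by (simp add: colors_two_blocks_def colors_one_block_def)
  also have "?f j = 1" by (simp add: colors_two_blocks_def)
  also have "prod ?f {1..<i} = (\<Prod>x\<in>{1..<i}. c - 1)"
    using assms(2)
    by (intro prod.cong) (simp_all add: colors_two_blocks_def colors_one_block_def cards)
  also have "prod ?f {i<..<j} = (\<Prod>x\<in>{i<..<j}. if x \<in> Y then c else c - 2)"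
    using assms(6,8)
    by (intro prod.cong) (auto simp: colors_two_blocks_def colors_one_block_def cards(3))
  also have "\<dots> = c ^ card Y * (c - 2) ^ (j - i - card Y - 1)"
    using assms(7) by (simp add: prod_if_mem)
  also have "prod ?f {j<..n} = (\<Prod>x\<in>{j<..n}. c - 1)"
    by (intro prod.cong) (simp_all add: colors_two_blocks_def cards)
  also have "(\<Prod>x\<in>{1..<i}. c - 1) = (c - 1) ^ (i - 1)" by simp
  also have "(\<Prod>x\<in>{j<..n}. c - 1) = (c - 1) ^ (n - j)" by simp
  finally have "prod ?f {1..n}
      = c ^ card Y * ((c - 1) ^ (n - j) * (c - 1) ^ (i - 1)) * (c - 2) ^ (j - i - card Y - 1)"
    by (simp only: mult_ac mult_1)
  \<comment> \<open>Since \<open>i \<ge> 1\<close>, the truncated difference \<open>i - 1\<close>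
    can be merged into the sum of the exponents.\<close>
  also have "(c - 1) ^ (n - j) * (c - 1) ^ (i - 1) = (c - 1) ^ (n - j + i - 1)"
    using assms(1) by (simp flip: power_add)
  finally show ?thesis .
qed

text \<open>The blocks of \<open>i\<close> and \<open>j\<close> are cut into their parts before
  \<open>i\<close>, between \<open>i\<close> and \<open>j\<close>, and after \<open>j\<close>, with
  sizes \<open>(p, q)\<close>, \<open>(r, s)\<close> and \<open>(t, u)\<close>; only
  \<open>r\<close> affects the color count.\<close>

lemma card_avoiders_two_blocks:
  assumes "i \<in> {1..n}" "j \<in> {i<..n}" "a \<in> {1..c}" "b \<in> {1..c}" "a \<noteq> b"
  shows "card (avoiders_two_blocks n c a b i j) =
    (\<Sum>(p, q)\<in>pairs_le (int i - 1).
     \<Sum>(r, s)\<in>pairs_le (int j - int i - 1).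
     \<Sum>(t, u)\<in>pairs_le (int n - int j).
        trinomial (i - 1) p q * trinomial (j - i - 1) r s * trinomial (n - j) t u
        * Bell (n - p - q - r - s - t - u - 2)
        * c ^ r * (c - 1) ^ (n - j + i - 1) * (c - 2) ^ (j - i - r - 1))"
proof -
  let ?g = "\<lambda>X. \<Prod>x\<in>{1..n}. card (colors_two_blocks c a b i j X x)"
  let ?I = "{1..<i}" and ?J = "{i<..<j}" and ?N = "{j<..n}"
  let ?h = "\<lambda>p q r s t u. Bell (n - p - q - r - s - t - u - 2)
      * (c ^ r * (c - 1) ^ (n - j + i - 1) * (c - 2) ^ (j - i - r - 1))"
  have finc: "finite (colors_two_blocks c a b i j X x)" for X x
    by (simp add: colors_two_blocks_def colors_one_block_def)
  have fins: "finite {P. partition_on {1..n} P \<and> j \<notin> block_of P i}"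
    by (rule finite_subset[OF _ finitely_many_partition_on[of "{1..n}"]]) auto
  have "card (avoiders_two_blocks n c a b i j)
      = (\<Sum>P | partition_on {1..n} P \<and> j \<notin> block_of P i. ?g (block_of P i))"
    unfolding avoiders_two_blocks_def
    by (subst card_SigmaI) (use fins in \<open>auto simp: card_PiE finc intro!: finite_PiE\<close>)
  also have "\<dots> = (\<Sum>(X, Y)\<in>disjoint_pairs ({1..n} - {i, j}).
      Bell (card {1..n} - card X - card Y - 2) * ?g (insert i X))"
    by (rule sum_partitions_by_two_blocks) (use assms in auto)
  also have "{1..n} - {i, j} = ?I \<union> (?J \<union> ?N)" using assms(1,2) by auto
  also have "(\<Sum>(X, Y)\<in>disjoint_pairs (?I \<union> (?J \<union> ?N)).
      Bell (card {1..n} - card X - card Y - 2) * ?g (insert i X))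
    = (\<Sum>(X1, Y1)\<in>disjoint_pairs ?I. \<Sum>(X', Y')\<in>disjoint_pairs (?J \<union> ?N).
        Bell (card {1..n} - card (X1 \<union> X') - card (Y1 \<union> Y') - 2) * ?g (insert i (X1 \<union> X')))"
    by (rule sum_disjoint_pairs_Un) (use assms(2) in auto)
  also have "\<dots> = (\<Sum>(X1, Y1)\<in>disjoint_pairs ?I. \<Sum>(X2, Y2)\<in>disjoint_pairs ?J.
      \<Sum>(X3, Y3)\<in>disjoint_pairs ?N.
        Bell (card {1..n} - card (X1 \<union> (X2 \<union> X3)) - card (Y1 \<union> (Y2 \<union> Y3)) - 2)
        * ?g (insert i (X1 \<union> (X2 \<union> X3))))"
    by (intro sum.cong refl, clarify, rule sum_disjoint_pairs_Un) auto
  also have "\<dots> = (\<Sum>(X1, Y1)\<in>disjoint_pairs ?I. \<Sum>(X2, Y2)\<in>disjoint_pairs ?J.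
      \<Sum>(X3, Y3)\<in>disjoint_pairs ?N.
        ?h (card X1) (card Y1) (card X2) (card Y2) (card X3) (card Y3))"
  proof (intro sum.cong refl, clarify, intro sum.cong refl, clarify, intro sum.cong refl, clarify)
    fix X1 Y1 X2 Y2 X3 Y3
    assume "(X1, Y1) \<in> disjoint_pairs ?I" "(X2, Y2) \<in> disjoint_pairs ?J"
      "(X3, Y3) \<in> disjoint_pairs ?N"
    then have X: "X1 \<subseteq> ?I" "X2 \<subseteq> ?J" "X3 \<subseteq> ?N" and Y: "Y1 \<subseteq> ?I" "Y2 \<subseteq> ?J" "Y3 \<subseteq> ?N"
      by (auto simp: disjoint_pairs_def)
    have card_Un: "card (U1 \<union> (U2 \<union> U3)) = card U1 + (card U2 + card U3)"
      if U: "U1 \<subseteq> ?I" "U2 \<subseteq> ?J" "U3 \<subseteq> ?N" for U1 U2 U3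
    proof -
      have "finite U1" "finite U2" "finite U3" using U by (auto intro: finite_subset)
      moreover have "U2 \<inter> U3 = {}" "U1 \<inter> (U2 \<union> U3) = {}" using U assms(2) by force+
      ultimately show ?thesis by (simp add: card_Un_disjoint)
    qed
    have "n - (card X1 + (card X2 + card X3)) - (card Y1 + (card Y2 + card Y3)) - 2
        = n - card X1 - card Y1 - card X2 - card Y2 - card X3 - card Y3 - 2" by simp
    then show "Bell (card {1..n} - card (X1 \<union> (X2 \<union> X3)) - card (Y1 \<union> (Y2 \<union> Y3)) - 2)
        * ?g (insert i (X1 \<union> (X2 \<union> X3)))
      = ?h (card X1) (card Y1) (card X2) (card Y2) (card X3) (card Y3)"
      unfolding card_Un[OF X] card_Un[OF Y] prod_card_colors_two_blocks[OF assms X] by simp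
  qed
  also have "\<dots> = (\<Sum>(X1, Y1)\<in>disjoint_pairs ?I. \<Sum>(X2, Y2)\<in>disjoint_pairs ?J.
      \<Sum>(t, u)\<in>pairs_le (int (card ?N)). trinomial (card ?N) t u
        * ?h (card X1) (card Y1) (card X2) (card Y2) t u)"
    by (intro sum.cong refl, clarify, intro sum.cong refl, clarify,
        rule sum_disjoint_pairs_card) simp
  also have "\<dots> = (\<Sum>(X1, Y1)\<in>disjoint_pairs ?I.
      \<Sum>(r, s)\<in>pairs_le (int (card ?J)). trinomial (card ?J) r s *
      (\<Sum>(t, u)\<in>pairs_le (int (card ?N)). trinomial (card ?N) t u
        * ?h (card X1) (card Y1) r s t u))"
    by (intro sum.cong refl, clarify, rule sum_disjoint_pairs_card) simp
  also have "\<dots> = (\<Sum>(p, q)\<in>pairs_le (int (card ?I)). trinomial (card ?I) p q *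
      (\<Sum>(r, s)\<in>pairs_le (int (card ?J)). trinomial (card ?J) r s *
      (\<Sum>(t, u)\<in>pairs_le (int (card ?N)). trinomial (card ?N) t u * ?h p q r s t u)))"
    by (rule sum_disjoint_pairs_card) simp
  \<comment> \<open>The integer bounds agree with the interval lengths because
    \<open>1 \<le> i < j \<le> n\<close>.\<close>
  also have "int (card ?I) = int i - 1" using assms(1) by auto
  also have "int (card ?J) = int j - int i - 1" using assms(2) by auto
  also have "int (card ?N) = int n - int j" using assms(2) by auto
  also have "card ?I = i - 1" by simp
  also have "card ?J = j - i - 1" by simp
  also have "card ?N = n - j" by simp
  finally show ?thesis by (simp only: sum_distrib_left mult.assoc case_prod_unfold)
qed

section \<open>Matching the index ranges of the formula\<close>

theorem theorem2p4:
  fixes n c a b :: nat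
  assumes "c \<ge> 2" and "n \<ge> 1"
    and "a \<in> {1..c}" and "b \<in> {1..c}" and "a \<noteq> b"
  shows "card (eq_avoiders_12 n c a b) =
    Bell n * (c - 1) ^ n
    + (\<Sum>i=0..n. \<Sum>k=0..n - i. \<Sum>l=0..<i.
        ((n - i) choose k) * ((i - 1) choose l) * Bell (n - k - l - 1)
        * c ^ k * (c - 1) ^ (i - 1) * (c - 2) ^ (n - i - k))
    + (\<Sum>i=0..n - 1. \<Sum>j=i + 1..n.
        \<Sum>(p, q)\<in>pairs_le (int i - 1).
        \<Sum>(r, s)\<in>pairs_le (int j - int i - 1).
        \<Sum>(t, u)\<in>pairs_le (int n - int j).
        trinomial (i - 1) p q * trinomial (j - i - 1) r s * trinomial (n - j) t u
        * Bell (n - p - q - r - s - t - u - 2)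
        * c ^ r * (c - 1) ^ (n - j + i - 1) * (c - 2) ^ (j - i - r - 1))"
    (is "_ = _ + sum ?F {0..n} + (\<Sum>i=0..n - 1. \<Sum>j=i + 1..n. ?G i j)")
proof -
  \<comment> \<open>For \<open>i = 0\<close> the range of \<open>l\<close> is empty, so this term
    vanishes.\<close>
  have "sum ?F {0..n} = sum ?F {1..n}"
    by (rule sum.mono_neutral_right) auto
  also have "\<dots> = (\<Sum>i=1..n. card (avoiders_one_block n c a b i))"
    using card_avoiders_one_block[OF _ assms(3-5)] by (intro sum.cong refl) simp
  finally have F: "sum ?F {0..n} = (\<Sum>i=1..n. card (avoiders_one_block n c a b i))" .
  \<comment> \<open>The bound is the integer \<open>-1\<close>, not a truncated difference, so the
    term \<open>i = 0\<close> is an empty sum.\<close>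
  have "pairs_le (int 0 - 1) = {}" by (auto simp: pairs_le_def)
  then have G0: "(\<Sum>j=0 + 1..n. ?G 0 j) = 0" by (simp only: sum.empty sum.neutral_const)
  have "(\<Sum>i=0..n - 1. \<Sum>j=i + 1..n. ?G i j) = (\<Sum>i\<in>{1..n - 1}. \<Sum>j=i + 1..n. ?G i j)"
  proof (rule sum.mono_neutral_right)
    show "\<forall>i\<in>{0..n - 1} - {1..n - 1}. (\<Sum>j=i + 1..n. ?G i j) = 0"
    proof
      fix i assume "i \<in> {0..n - 1} - {1..n - 1}"
      then have "i = 0" by auto
      then show "(\<Sum>j=i + 1..n. ?G i j) = 0" using G0 by (simp only:)
    qed
  qed auto
  \<comment> \<open>The additional index \<open>i = n\<close> admits no \<open>j\<close>.\<close>
  also have "\<dots> = (\<Sum>i=1..n. \<Sum>j=i + 1..n. ?G i j)"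
    by (rule sum.mono_neutral_left) auto
  also have "\<dots> = (\<Sum>i=1..n. \<Sum>j\<in>{i<..n}. card (avoiders_two_blocks n c a b i j))"
  proof (rule sum.cong[OF refl])
    fix i assume i: "i \<in> {1..n}"
    have "{i + 1..n} = {i<..n}" by auto
    then show "(\<Sum>j=i + 1..n. ?G i j) = (\<Sum>j\<in>{i<..n}. card (avoiders_two_blocks n c a b i j))"
      using card_avoiders_two_blocks[OF i _ assms(3-5)] by (intro sum.cong) simp_all
  qed
  finally show ?thesis
    unfolding F card_eq_avoiders_12[OF assms(3,5)] card_avoiders_no_a[OF assms(3)] by simp
qed

end
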